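(* Let $(X,A,B,p,q,k,s)$ be a semibiproduct of monoids. If $pk=0$ then $k$ is the kernel of $p$ in the category of monoids.
   Context: A semibiproduct of monoids $(X,A,B,p,q,k,s)$ consists of monoids $X,A,B$ (written additively with neutral element $0$, not necessarily commutative), monoid homomorphisms $k\colon X\to A$ and $p\colon A\to B$, and set-theoretical maps $q\colon A\to X$ and $s\colon B\to A$ (not required to be homomorphisms), such that $kq(a)+sp(a)=a$ for all $a\in A$, $ps=1_B$ and $qk=1_X$. Composition of maps is written by juxtaposition; $0$ also denotes the trivial homomorphism, constantly equal to the neutral element. *)

theory Defs
  imports "HOL-Algebra.Coset"
begin

(* The library's hom does not require preservation of the neutral element,
   which is not automatic for monoids. *)
definition monoid_hom :: "('a, 'm) monoid_scheme \<Rightarrow> ('b, 'n) monoid_scheme \<Rightarrow> ('a \<Rightarrow> 'b) set"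
  where "monoid_hom G H = {h \<in> hom G H. h \<one>\<^bsub>G\<^esub> = \<one>\<^bsub>H\<^esub>}"

(* Monoid operations are written multiplicatively, as in HOL-Algebra; maps are relevant
   only on the carriers, so equations between maps are stated pointwise there. *)
locale semibiproduct =
  X: monoid X + A: monoid A + B: monoid B
  for X :: "('x, 'l) monoid_scheme"
    and A :: "('a, 'm) monoid_scheme"
    and B :: "('b, 'n) monoid_scheme"
    and p :: "'a \<Rightarrow> 'b" and q :: "'a \<Rightarrow> 'x" and k :: "'x \<Rightarrow> 'a" and s :: "'b \<Rightarrow> 'a" +
  assumes p_hom: "p \<in> monoid_hom A B"
    and k_hom: "k \<in> monoid_hom X A"
    and q_map: "q \<in> carrier A \<rightarrow> carrier X"
    and s_map: "s \<in> carrier B \<rightarrow> carrier A"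
    and kq_sp: "a \<in> carrier A \<Longrightarrow> k (q a) \<otimes>\<^bsub>A\<^esub> s (p a) = a"
    and p_s: "b \<in> carrier B \<Longrightarrow> p (s b) = b"
    and q_k: "x \<in> carrier X \<Longrightarrow> q (k x) = x"

(* The universal property of the kernel in the category of monoids. HOL cannot quantify over
   types inside a formula, so the universe 'y of the test monoids Y is a type parameter; being a
   kernel means that the predicate holds for every type 'y. Morphisms are functions modulo
   equality on the carrier of their domain, and the uniqueness clause is to be read so. *)
definition is_monoid_kernel ::
    "'y itself \<Rightarrow> ('x, 'l) monoid_scheme \<Rightarrow> ('a, 'm) monoid_scheme \<Rightarrow> ('b, 'n) monoid_scheme \<Rightarrow>
     ('x \<Rightarrow> 'a) \<Rightarrow> ('a \<Rightarrow> 'b) \<Rightarrow> bool"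
  where "is_monoid_kernel (_ :: 'y itself) X A B k p \<longleftrightarrow>
    monoid X \<and> monoid A \<and> monoid B \<and> k \<in> monoid_hom X A \<and> p \<in> monoid_hom A B \<and>
    trivial_homomorphism X B (p \<circ> k) \<and>
    (\<forall>(Y :: 'y monoid) f. monoid Y \<and> f \<in> monoid_hom Y A \<and> trivial_homomorphism Y B (p \<circ> f) \<longrightarrow>
      (\<exists>g \<in> monoid_hom Y X. (\<forall>y \<in> carrier Y. k (g y) = f y) \<and>
        (\<forall>g' \<in> monoid_hom Y X. (\<forall>y \<in> carrier Y. k (g' y) = f y) \<longrightarrow>
          (\<forall>y \<in> carrier Y. g' y = g y))))"

end

(* Since q(0) = q(k(0)) = 0, the decomposition of 0 gives s(0) = 0. Hence a = k(q(a)) whenever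
   p(a) = 0, so every f with p f = 0 factors through k as k(q f); since q k = 1, the map k is
   injective, which makes the factorization unique and q f a homomorphism. *)
theory Submission
  imports Defs
begin

lemma monoid_hom_carrier:
  "h \<in> monoid_hom G H \<Longrightarrow> x \<in> carrier G \<Longrightarrow> h x \<in> carrier H"
  by (auto simp: monoid_hom_def hom_def)

lemma monoid_hom_mult:
  "h \<in> monoid_hom G H \<Longrightarrow> x \<in> carrier G \<Longrightarrow> y \<in> carrier G \<Longrightarrow>
    h (x \<otimes>\<^bsub>G\<^esub> y) = h x \<otimes>\<^bsub>H\<^esub> h y"
  by (auto simp: monoid_hom_def hom_def)

lemma monoid_hom_one: "h \<in> monoid_hom G H \<Longrightarrow> h \<one>\<^bsub>G\<^esub> = \<one>\<^bsub>H\<^esub>"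
  by (simp add: monoid_hom_def)

context semibiproduct
begin

lemma q_carrier: "a \<in> carrier A \<Longrightarrow> q a \<in> carrier X"
  using q_map by blast

lemma k_carrier: "x \<in> carrier X \<Longrightarrow> k x \<in> carrier A"
  using k_hom by (rule monoid_hom_carrier)

lemma q_one: "q \<one>\<^bsub>A\<^esub> = \<one>\<^bsub>X\<^esub>"
  using q_k[OF X.one_closed] by (simp add: monoid_hom_one[OF k_hom])

lemma s_one: "s \<one>\<^bsub>B\<^esub> = \<one>\<^bsub>A\<^esub>"
proof -
  \<comment> \<open>Membership in the carrier is what allows the left unit to be cancelled in the
    decomposition of the neutral element.\<close>
  have "s \<one>\<^bsub>B\<^esub> \<in> carrier A"
    using s_map by blast
  then show ?thesis
    using kq_sp[OF A.one_closed]
    by (simp add: q_one monoid_hom_one[OF k_hom] monoid_hom_one[OF p_hom])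
qed

text \<open>The factor \<open>s (p a)\<close> of the decomposition of \<open>a\<close> becomes
  neutral, so only \<open>k (q a)\<close> remains.\<close>

lemma k_q_of_kernel:
  assumes "a \<in> carrier A" "p a = \<one>\<^bsub>B\<^esub>"
  shows "k (q a) = a"
  using kq_sp[OF assms(1)] assms by (simp add: s_one q_carrier k_carrier)

lemma inj_on_k: "inj_on k (carrier X)"
  by (rule inj_on_inverseI) (rule q_k)

text \<open>The map \<open>q\<close> is not assumed to be multiplicative. The composite is, because
  \<open>f\<close> takes values where \<open>p\<close> is trivial, and there \<open>q\<close>
  inverts the injective homomorphism \<open>k\<close>.\<close>

lemma q_comp_monoid_hom:
  assumes Y: "monoid Y" and f: "f \<in> monoid_hom Y A"
    and pf: "\<And>y. y \<in> carrier Y \<Longrightarrow> p (f y) = \<one>\<^bsub>B\<^esub>"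
  shows "q \<circ> f \<in> monoid_hom Y X"
proof -
  interpret Y: monoid Y by fact
  note fc = monoid_hom_carrier[OF f]
  have kqf: "k (q (f y)) = f y" if "y \<in> carrier Y" for y
    using that by (intro k_q_of_kernel fc pf)
  have "q (f (y \<otimes>\<^bsub>Y\<^esub> z)) = q (f y) \<otimes>\<^bsub>X\<^esub> q (f z)"
    if "y \<in> carrier Y" "z \<in> carrier Y" for y z
  \<comment> \<open>It suffices to compare images under \<open>k\<close>: both equal
    \<open>f y \<otimes> f z\<close>.\<close>
  proof (rule inj_onD[OF inj_on_k])
    show "k (q (f (y \<otimes>\<^bsub>Y\<^esub> z))) = k (q (f y) \<otimes>\<^bsub>X\<^esub> q (f z))"
      \<comment> \<open>The instance of \<open>kqf\<close> at the product is supplied as a fact,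
        since simplification splits \<open>f\<close> of the product before \<open>kqf\<close> could
        match.\<close>
      using that kqf[OF Y.m_closed[OF that]]
      by (simp add: kqf monoid_hom_mult[OF f] monoid_hom_mult[OF k_hom] q_carrier fc)
  qed (use that in \<open>simp_all add: q_carrier fc\<close>)
  then show ?thesis
    by (auto simp: monoid_hom_def hom_def q_carrier fc monoid_hom_one[OF f] q_one)
qed

end

theorem corollary3:
  fixes X :: "('x, 'l) monoid_scheme"
    and A :: "('a, 'm) monoid_scheme"
    and B :: "('b, 'n) monoid_scheme"
    and p :: "'a \<Rightarrow> 'b" and q :: "'a \<Rightarrow> 'x" and k :: "'x \<Rightarrow> 'a" and s :: "'b \<Rightarrow> 'a"
  assumes "semibiproduct X A B p q k s"
    and "trivial_homomorphism X B (p \<circ> k)"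
  shows "is_monoid_kernel TYPE('y) X A B k p"
proof -
  interpret semibiproduct X A B p q k s by fact
  have universal: "\<exists>g \<in> monoid_hom Y X. (\<forall>y \<in> carrier Y. k (g y) = f y) \<and>
      (\<forall>g' \<in> monoid_hom Y X. (\<forall>y \<in> carrier Y. k (g' y) = f y) \<longrightarrow>
        (\<forall>y \<in> carrier Y. g' y = g y))"
    if Y: "monoid Y" and f: "f \<in> monoid_hom Y A" and triv: "trivial_homomorphism Y B (p \<circ> f)"
    for Y :: "'y monoid" and f
  proof (intro bexI conjI ballI impI)
    have pf: "p (f y) = \<one>\<^bsub>B\<^esub>" if "y \<in> carrier Y" for y
      using triv that by (simp add: trivial_homomorphism_def)
    \<comment> \<open>This fixes the witness that \<open>bexI\<close> left open. The choice is
      forced: applying \<open>q\<close> to \<open>k (g' y) = f y\<close> gives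
      \<open>g' y = q (f y)\<close>.\<close>
    show "q \<circ> f \<in> monoid_hom Y X"
      using Y f pf by (rule q_comp_monoid_hom)
    show "k ((q \<circ> f) y) = f y" if "y \<in> carrier Y" for y
      using k_q_of_kernel[OF monoid_hom_carrier[OF f that] pf[OF that]] by simp
    show "g' y = (q \<circ> f) y"
      if "g' \<in> monoid_hom Y X" "\<forall>y \<in> carrier Y. k (g' y) = f y" "y \<in> carrier Y" for g' y
      using q_k[OF monoid_hom_carrier[OF that(1,3)]] that(2,3) by simp
  qed
  show ?thesis
    unfolding is_monoid_kernel_def
    using X.monoid_axioms A.monoid_axioms B.monoid_axioms k_hom p_hom assms(2) universal
    by blast
qed

end
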